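(* Let $D, C$ be positive integers and let $\mathcal{M}$ be a graph node-classification model, i.e. a function assigning to every attributed graph $\mathbf{G}=(\mathbf{A},\mathbf{F})$ on $N$ nodes (for every $N\ge 1$) with $D$-dimensional node features a vector of labels $\mathcal{M}(\mathbf{G})\in\{1,\dots,C\}^N$. If $\mathcal{M}$ is non-structural-ignorant and permutation invariant, then $\mathcal{M}$ is GIA-attackable.
   Context: An attributed graph on $N$ nodes $\{1,\dots,N\}$ is a pair $\mathbf{G}=(\mathbf{A},\mathbf{F})$, where $\mathbf{A}\in\mathbb{R}^{N\times N}$ is the adjacency matrix of the $N$ nodes and $\mathbf{F}\in\mathbb{R}^{N\times D}$ is the node feature matrix, whose $i$-th row $\mathbf{F}_i$ is the feature vector of node $i$. For a model $\mathcal{M}$, $\mathcal{M}(\mathbf{G})_i\in\{1,\dots,C\}$ denotes the label predicted for node $i$ of $\mathbf{G}$. The model is defined on attributed graphs of every size $N$, with $D$ and $C$ fixed. Permutation invariant: An attributed graph $\mathbf{G}'=(\mathbf{A}',\mathbf{F}')$ on $N$ nodes is a permutation of $\mathbf{G}=(\mathbf{A},\mathbf{F})$ via a permutation $\sigma$ of $\{1,\dots,N\}$ if $\mathbf{F}'_{\sigma_i}=\mathbf{F}_i$ for all $i$ and $\mathbf{A}'_{\sigma_i\sigma_j}=\mathbf{A}_{ij}$ for all $i,j$. The model $\mathcal{M}$ is permutation invariant if, whenever $\mathbf{G}'$ is a permutation of $\mathbf{G}$ via $\sigma$, one has $\mathcal{M}(\mathbf{G}')_{\sigma_i}=\mathcal{M}(\mathbf{G})_i$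 for all $i\in\{1,\dots,N\}$. Non-structural-ignorant: $\mathcal{M}$ is non-structural-ignorant if there exist two attributed graphs $\mathbf{G}_1=(\mathbf{A}_1,\mathbf{F})$ and $\mathbf{G}_2=(\mathbf{A}_2,\mathbf{F})$ on the same number of nodes with the same feature matrix $\mathbf{F}$, with $\mathbf{A}_1\neq\mathbf{A}_2$, and a node $i$ such that $\mathcal{M}(\mathbf{G}_1)_i\neq\mathcal{M}(\mathbf{G}_2)_i$. GIA-attackable: $\mathcal{M}$ is GIA-attackable (GIA stands for graph injection attack) if there exist two attributed graphs $\mathbf{G}_1,\mathbf{G}_2$ containing the same node $i$ such that $\mathbf{G}_1$ is an induced subgraph of $\mathbf{G}_2$ and $\mathcal{M}(\mathbf{G}_1)_i\neq\mathcal{M}(\mathbf{G}_2)_i$. Here $\mathbf{G}_1=(\mathbf{A}_1,\mathbf{F}_1)$ on $N_1$ nodes is an induced subgraph of $\mathbf{G}_2=(\mathbf{A}_2,\mathbf{F}_2)$ on $N_2$ nodes if there is an injection $\iota:\{1,\dots,N_1\}\to\{1,\dots,N_2\}$ with $(\mathbf{A}_2)_{\iota(a)\iota(b)}=(\mathbf{A}_1)_{ab}$ and $(\mathbf{F}_2)_{\iota(a)}=(\mathbf{F}_1)_a$ for all $a,b$; node $i$ of $\mathbf{G}_1$ is identified with node $\iota(i)$ of $\mathbf{G}_2$, so that the inequality reads $\mathcal{M}(\mathbf{G}_1)_i\neq\mathcal{M}(\mathbf{G}_2)_{\iota(i)}$.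
   Formalization: Adjacency matrices are required to have zero diagonal (no self-loops) throughout; with arbitrary diagonals the claim fails, e.g. for the model labelling node i by whether A_ii = 0. *)

theory Defs
  imports Complex_Main "Jordan_Normal_Form.Matrix" "HOL-Combinatorics.Permutations"
begin

text \<open>
  Nodes are indexed from \<open>0\<close>, following the matrix library: the node set of a graph on \<open>N\<close> nodes
  is \<open>{..<N}\<close>. Labels are \<open>1, \<dots>, C\<close>.

  Adjacency matrices may be weighted and directed, but describe graphs without self-loops, so their
  diagonal vanishes. With unrestricted diagonals, a model whose label of node \<open>i\<close> depends
  only on whether the diagonal entry at \<open>i\<close> vanishes is permutation invariant and
  non-structural-ignorant, but not GIA-attackable, because an induced subgraph preserves diagonal
  entries.
\<close>

type_synonym attributed_graph = "real mat \<times> real mat"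

definition attributed_graphs :: "nat \<Rightarrow> nat \<Rightarrow> attributed_graph set" where
  "attributed_graphs D N =
    {(A, F). N \<ge> 1 \<and> A \<in> carrier_mat N N \<and> (\<forall>i<N. A $$ (i, i) = 0) \<and> F \<in> carrier_mat N D}"

text \<open>A model is a total function in HOL; its values outside of the attributed graphs
  with \<open>D\<close>-dimensional features are irrelevant in all definitions below.\<close>

definition classification_model :: "nat \<Rightarrow> nat \<Rightarrow> (attributed_graph \<Rightarrow> nat vec) \<Rightarrow> bool" where
  "classification_model D C M \<longleftrightarrow>
    (\<forall>N. \<forall>G \<in> attributed_graphs D N. M G \<in> carrier_vec N \<and> (\<forall>i<N. M G $ i \<in> {1..C}))"

fun is_permutation_via ::
    "nat \<Rightarrow> (nat \<Rightarrow> nat) \<Rightarrow> attributed_graph \<Rightarrow> attributed_graph \<Rightarrow> bool" where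
  "is_permutation_via N \<sigma> (A', F') (A, F) \<longleftrightarrow>
    \<sigma> permutes {..<N} \<and>
    (\<forall>i<N. row F' (\<sigma> i) = row F i) \<and>
    (\<forall>i<N. \<forall>j<N. A' $$ (\<sigma> i, \<sigma> j) = A $$ (i, j))"

definition permutation_invariant :: "nat \<Rightarrow> (attributed_graph \<Rightarrow> nat vec) \<Rightarrow> bool" where
  "permutation_invariant D M \<longleftrightarrow>
    (\<forall>N \<sigma>. \<forall>G \<in> attributed_graphs D N. \<forall>G' \<in> attributed_graphs D N.
      is_permutation_via N \<sigma> G' G \<longrightarrow> (\<forall>i<N. M G' $ \<sigma> i = M G $ i))"

definition non_structural_ignorant :: "nat \<Rightarrow> (attributed_graph \<Rightarrow> nat vec) \<Rightarrow> bool" where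
  "non_structural_ignorant D M \<longleftrightarrow>
    (\<exists>N A\<^sub>1 A\<^sub>2 F. (A\<^sub>1, F) \<in> attributed_graphs D N \<and> (A\<^sub>2, F) \<in> attributed_graphs D N \<and>
      A\<^sub>1 \<noteq> A\<^sub>2 \<and> (\<exists>i<N. M (A\<^sub>1, F) $ i \<noteq> M (A\<^sub>2, F) $ i))"

fun induced_subgraph_via ::
    "nat \<Rightarrow> nat \<Rightarrow> (nat \<Rightarrow> nat) \<Rightarrow> attributed_graph \<Rightarrow> attributed_graph \<Rightarrow> bool" where
  "induced_subgraph_via N\<^sub>1 N\<^sub>2 \<iota> (A\<^sub>1, F\<^sub>1) (A\<^sub>2, F\<^sub>2) \<longleftrightarrow>
    \<iota> \<in> {..<N\<^sub>1} \<rightarrow> {..<N\<^sub>2} \<and> inj_on \<iota> {..<N\<^sub>1} \<and>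
    (\<forall>a<N\<^sub>1. \<forall>b<N\<^sub>1. A\<^sub>2 $$ (\<iota> a, \<iota> b) = A\<^sub>1 $$ (a, b)) \<and>
    (\<forall>a<N\<^sub>1. row F\<^sub>2 (\<iota> a) = row F\<^sub>1 a)"

definition GIA_attackable :: "nat \<Rightarrow> (attributed_graph \<Rightarrow> nat vec) \<Rightarrow> bool" where
  "GIA_attackable D M \<longleftrightarrow>
    (\<exists>N\<^sub>1 N\<^sub>2 \<iota>. \<exists>G\<^sub>1 \<in> attributed_graphs D N\<^sub>1. \<exists>G\<^sub>2 \<in> attributed_graphs D N\<^sub>2.
      induced_subgraph_via N\<^sub>1 N\<^sub>2 \<iota> G\<^sub>1 G\<^sub>2 \<and> (\<exists>i<N\<^sub>1. M G\<^sub>1 $ i \<noteq> M G\<^sub>2 $ \<iota> i))"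

end

(* Both graphs are induced subgraphs of a single larger graph in which they share only the node i;
   this is possible because both have the same features and a zero diagonal entry at i. The label
   of i in the larger graph differs from its label in one of the two, and that one is attacked. *)
theory Submission
  imports Defs
begin

(* The first graph occupies {..<N}, and node j \<noteq> i of the second graph becomes N + j. Node N + i lies
   outside of both copies; it only keeps the indexing uniform. *)
lemma amalgamation_over_node:
  assumes G1: "(A\<^sub>1, F) \<in> attributed_graphs D N" and G2: "(A\<^sub>2, F) \<in> attributed_graphs D N"
    and "i < N"
  obtains G \<iota> where "G \<in> attributed_graphs D (2 * N)"
    "induced_subgraph_via N (2 * N) id (A\<^sub>1, F) G"
    "induced_subgraph_via N (2 * N) \<iota> (A\<^sub>2, F) G" "\<iota> i = i"
proof -
  define \<iota> where "\<iota> = (\<lambda>j. if j = i then i else N + j)"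
  \<comment> \<open>Reduction \<open>mod N\<close> recovers the original index in either copy. The
    two blocks overlap only at \<open>(i, i)\<close>; entries outside both blocks lie off the
    diagonal and could be arbitrary.\<close>
  define A where "A = mat (2 * N) (2 * N) (\<lambda>(a, b).
    if a < N \<and> b < N then A\<^sub>1 $$ (a, b)
    else if a \<in> {i} \<union> {N..} \<and> b \<in> {i} \<union> {N..} then A\<^sub>2 $$ (a mod N, b mod N)
    else 0)"
  define F' where "F' = mat (2 * N) D (\<lambda>(a, k). F $$ (a mod N, k))"
  have F: "F \<in> carrier_mat N D" and diag: "\<And>a. a < N \<Longrightarrow> A\<^sub>1 $$ (a, a) = 0"
      "\<And>a. a < N \<Longrightarrow> A\<^sub>2 $$ (a, a) = 0"
    using G1 G2 by (auto simp: attributed_graphs_def)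
  have row: "row F' a = row F (a mod N)" if "a < 2 * N" for a
    using that F \<open>i < N\<close> by (intro eq_vecI) (auto simp: F'_def)
  have "(A, F') \<in> attributed_graphs D (2 * N)"
    using \<open>i < N\<close> diag by (auto simp: attributed_graphs_def A_def F'_def)
  moreover have "induced_subgraph_via N (2 * N) id (A\<^sub>1, F) (A, F')"
    using row by (auto simp: A_def)
  \<comment> \<open>At \<open>(i, i)\<close> the first branch of \<open>A\<close> wins and gives
    \<open>A\<^sub>1\<close>; this agrees with \<open>A\<^sub>2\<close> since both entries are
    0.\<close>
  moreover have "induced_subgraph_via N (2 * N) \<iota> (A\<^sub>2, F) (A, F')"
    using \<open>i < N\<close> row diag by (auto simp: A_def \<iota>_def inj_on_def)
  moreover have "\<iota> i = i"
    by (simp add: \<iota>_def)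
  ultimately show thesis
    by (rule that)
qed

theorem lemma4p1:
  fixes D C :: nat and M :: "attributed_graph \<Rightarrow> nat vec"
  assumes "D \<ge> 1" and "C \<ge> 1"
    and "classification_model D C M"
    and "non_structural_ignorant D M"
    and "permutation_invariant D M"
  shows "GIA_attackable D M"
proof -
  obtain N A\<^sub>1 A\<^sub>2 F i where G: "(A\<^sub>1, F) \<in> attributed_graphs D N" "(A\<^sub>2, F) \<in> attributed_graphs D N"
    and i: "i < N" and neq: "M (A\<^sub>1, F) $ i \<noteq> M (A\<^sub>2, F) $ i"
    using assms(4) by (auto simp: non_structural_ignorant_def)
  obtain G \<iota> where "G \<in> attributed_graphs D (2 * N)"
    "induced_subgraph_via N (2 * N) id (A\<^sub>1, F) G"
    "induced_subgraph_via N (2 * N) \<iota> (A\<^sub>2, F) G" "\<iota> i = i"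
    using amalgamation_over_node[OF G i] .
  \<comment> \<open>Both embeddings fix \<open>i\<close>, so one label \<open>M G $ i\<close> is
    compared with two distinct ones; \<open>id i\<close> is the form that
    \<open>GIA_attackable_def\<close> asks for.\<close>
  moreover have "M (A\<^sub>1, F) $ i \<noteq> M G $ id i \<or> M (A\<^sub>2, F) $ i \<noteq> M G $ i"
    using neq by auto
  ultimately show ?thesis
    unfolding GIA_attackable_def using G i by metis
qed

end
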